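(* Let $n\ge 11$ and let $a,b,c,d\ge 2$ be integers with $a+b+c+d\le n-2$ that are not all equal to $2$. Then $\mathbb{E}(T_n(a,b|c,d))<\mathbb{E}(T_n(2,2|2,2))$.
   Context: The energy $\mathbb{E}(G)$ is the sum of absolute values of the adjacency eigenvalues of $G$. For positive integers $a,b,c,d$ with $a+b+c+d\le n-2$, $T_n(a,b|c,d)$ is the tree of order $n$ obtained from the path $P_{n-a-b-c-d}$ by attaching two pendent paths of lengths $a$ and $b$ at one end vertex and two pendent paths of lengths $c$ and $d$ at the other end vertex. *)

theory Defs
  imports "Jordan_Normal_Form.Spectral_Radius"
begin

(* A finite simple graph of order n on the vertex set {0..<n}, given as the pair of n and its
   set of edges, each edge {u, v} being a two-element subset of {0..<n}. *)
type_synonym graph = "nat \<times> nat set set"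

fun adjacency_matrix :: "graph \<Rightarrow> complex mat" where
  "adjacency_matrix (n, E) = mat n n (\<lambda>(i, j). if {i, j} \<in> E then 1 else 0)"

(* Eigenvalues are counted with multiplicity. They are taken in the complex numbers, so that all
   n of them are counted by definition; since the matrix is real symmetric they are real, and
   cmod is the usual absolute value. *)
definition graph_energy :: "graph \<Rightarrow> real" where
  "graph_energy G =
     (let A = adjacency_matrix G
      in \<Sum>x\<in>spectrum A. real (order x (char_poly A)) * cmod x)"

definition path_graph :: "nat \<Rightarrow> graph" where
  "path_graph m = (m, {{i, Suc i} | i. Suc i < m})"

(* The l new vertices k, ..., k + l - 1 form a path whose first vertex k is joined to v. *)
fun attach_pendent_path :: "nat \<Rightarrow> nat \<Rightarrow> graph \<Rightarrow> graph" where
  "attach_pendent_path v l (k, E) =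
     (k + l, E \<union> {{if i = 0 then v else k + i - 1, k + i} | i. i < l})"

(* The end vertices of path_graph m are 0 and m - 1, and attaching paths keeps these names.
   The definition is meant for positive a, b, c, d with a + b + c + d + 2 \<le> n. *)
definition T :: "nat \<Rightarrow> nat \<Rightarrow> nat \<Rightarrow> nat \<Rightarrow> nat \<Rightarrow> graph" where
  "T n a b c d =
     (let m = n - a - b - c - d
      in attach_pendent_path (m - 1) d (attach_pendent_path (m - 1) c
           (attach_pendent_path 0 b (attach_pendent_path 0 a (path_graph m)))))"

end

theory Submission
  imports Defs "HOL-Real_Asymp.Real_Asymp"
begin

text \<open>
  For a tree with adjacency eigenvalues l, the number det (i s - A) has absolute value
  R s = prod sqrt (s^2 + l^2), which for s > 0 is a positive polynomial in s. Since
  pi * |l| is the integral over y > 1 of ln (1 + l^2 y^2) / y^2 + ln (1 + l^2 / y^2), it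
  suffices to compare ln (R (1 / y)) / y^2 + ln (R y) for all y > 1.

  Removing pendent vertices by Schur complements expresses R for T_n(a,b|c,d) through Fibonacci
  polynomials. If the path joining the branch vertices has an inner vertex, R increases
  pointwise when the pendent paths are shortened to length 2 in favour of that path. If the
  branch vertices are adjacent, only the reduction to T_n(2,2|2,t) is pointwise: T_n(2,2|2,2)
  then has the larger R for s < 1 and the smaller one for s > 1. There the values at y and 1 / y are weighed
  against each other, using ln (G / F) \<ge> 1 - F / G.
\<close>

section \<open>Fibonacci polynomials\<close>

text \<open>For s > 0, \<open>fibp s (Suc l)\<close> is the modulus of the characteristic polynomial
  of the path with l vertices at i s. Other initial values arise from modified weights at the end of
  a path.\<close>

fun lin_rec :: "real \<Rightarrow> real \<Rightarrow> real \<Rightarrow> nat \<Rightarrow> real" where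
  "lin_rec s p q 0 = p"
| "lin_rec s p q (Suc 0) = q"
| "lin_rec s p q (Suc (Suc k)) = s * lin_rec s p q (Suc k) + lin_rec s p q k"

abbreviation fibp :: "real \<Rightarrow> nat \<Rightarrow> real" where
  "fibp s \<equiv> lin_rec s 0 1"

lemma lin_rec_unique:
  fixes f :: "nat \<Rightarrow> real"
  assumes "\<And>k. f (Suc (Suc k)) = s * f (Suc k) + f k"
  shows "f k = lin_rec s (f 0) (f (Suc 0)) k"
  by (induction k rule: induct_nat_012) (simp_all add: assms)

text \<open>Identities in a path length rest on this principle: both sides obey the recurrence, so
  two initial values decide.\<close>

lemma lin_rec_eqI:
  fixes f g :: "nat \<Rightarrow> real"
  assumes "\<And>k. f (Suc (Suc k)) = s * f (Suc k) + f k"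
    and "\<And>k. g (Suc (Suc k)) = s * g (Suc k) + g k"
    and "f 0 = g 0" "f (Suc 0) = g (Suc 0)"
  shows "f k = g k"
  using lin_rec_unique[of f s k] lin_rec_unique[of g s k] assms by simp

lemma lin_rec_mult: "lin_rec s (r * p) (r * q) k = r * lin_rec s p q k"
  by (rule lin_rec_eqI[where s = s and f = "lin_rec s (r * p) (r * q)"]) (simp_all add: algebra_simps)

lemma lin_rec_Suc: "lin_rec s p q (Suc k) = q * fibp s (Suc k) + p * fibp s k"
  by (rule lin_rec_eqI[where s = s and f = "\<lambda>k. lin_rec s p q (Suc k)"]) (simp_all add: algebra_simps)

lemma lin_rec_fibp: "lin_rec s 1 s k = fibp s (Suc k)"
  by (cases k) (simp_all add: lin_rec_Suc[of s 1])

text \<open>For i, j > 0, cut a path of i + j vertices at the edge between its parts: matchings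
  avoiding that edge give the first product, those using it the second.\<close>

lemma fibp_add: "fibp s (Suc (i + j)) = fibp s (Suc i) * fibp s (Suc j) + fibp s i * fibp s j"
  by (rule lin_rec_eqI[where s = s and f = "\<lambda>i. fibp s (Suc (i + j))"]) (simp_all add: algebra_simps)

lemma lin_rec_pos:
  assumes "s > 0" "p > 0" "q > 0"
  shows "lin_rec s p q k > 0"
  using assms by (induction k rule: induct_nat_012) (auto intro!: add_pos_pos)

lemma fibp_pos: "s > 0 \<Longrightarrow> fibp s (Suc k) > 0"
  using lin_rec_pos[of s 1 s k] by (simp add: lin_rec_fibp)

lemma fibp_nonneg: "s > 0 \<Longrightarrow> fibp s k \<ge> 0"
  by (cases k) (auto intro: less_imp_le fibp_pos)

lemma fibp_Suc_mult_le:
  assumes "s > 0"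
  shows "s * fibp s k \<le> fibp s (Suc k)"
  using assms by (cases k) (auto simp: fibp_nonneg)

lemmas fibp_eval = eval_nat_numeral add_Suc add_Suc_right add_0 add_0_right BitM.simps lin_rec.simps
  power_Suc power_0

text \<open>The method name is qualified because HOL-Algebra hides it.\<close>

lemma fibp_mult_diff:
  "fibp s 3 * fibp s (i + j + 3) - fibp s (i + 3) * fibp s (j + 3) = fibp s i * fibp s j"
proof -
  \<comment> \<open>This bracketing lets \<open>fibp_add\<close> separate i from j; a polynomial
    identity in the values at i, i + 1, j and j + 1 remains.\<close>
  have e: "i + j + 3 = Suc (i + Suc (Suc j))"
    by simp
  show ?thesis
    unfolding e fibp_add unfolding fibp_eval by Groebner_Basis.algebra
qed

text \<open>The products belong to two pendent paths of lengths i + 2 and j + 2, and of lengths 2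
  and i + j + 2; they differ by a product of nonnegative numbers.\<close>

lemma fibp_mult_le:
  assumes "s > 0"
  shows "fibp s (i + 3) * fibp s (j + 3) \<le> fibp s 3 * fibp s (i + j + 3)"
  using fibp_mult_diff[of s i j] fibp_nonneg[OF assms, of i] fibp_nonneg[OF assms, of j]
    mult_nonneg_nonneg[of "fibp s i" "fibp s j"] by linarith

section \<open>The polynomials of the trees\<close>

text \<open>Here k is the number of inner vertices of the path between the two branch vertices, so
  the tree has order a + b + c + d + k + 2.\<close>

definition tree_poly :: "real \<Rightarrow> nat \<Rightarrow> nat \<Rightarrow> nat \<Rightarrow> nat \<Rightarrow> nat \<Rightarrow> real" where
  "tree_poly s a b c d k =
     (let Q = fibp s (Suc c) * fibp s (Suc d); Y = fibp s (Suc (Suc (c + d)))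
      in fibp s (Suc (Suc (a + b))) * lin_rec s Q Y (Suc k)
           + fibp s (Suc a) * fibp s (Suc b) * lin_rec s Q Y k)"

lemma tree_poly_rec:
  "tree_poly s a b c d (Suc (Suc k)) = s * tree_poly s a b c d (Suc k) + tree_poly s a b c d k"
  by (simp add: tree_poly_def Let_def algebra_simps)

lemma tree_poly_pos: "s > 0 \<Longrightarrow> tree_poly s a b c d k > 0"
  by (simp add: tree_poly_def Let_def fibp_pos lin_rec_pos add_pos_pos del: lin_rec.simps)

text \<open>The definition treats the branch vertices differently; with this symmetry, working at
  one of them suffices. The recurrence leaves only k = 0 and k = 1 to check.\<close>

lemma tree_poly_commute: "tree_poly s a b c d k = tree_poly s c d a b k"
  by (rule lin_rec_eqI[where s = s and f = "tree_poly s a b c d"], rule tree_poly_rec, rule tree_poly_rec)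
    (unfold tree_poly_def Let_def lin_rec.simps, simp_all only: algebra_simps)

text \<open>The sum of the two lengths is kept, so only the product
  \<open>fibp s (Suc a) * fibp s (Suc b)\<close> in the definition changes.\<close>

lemma tree_poly_branch_le:
  assumes "s > 0"
  shows "tree_poly s (i + 2) (j + 2) c d k \<le> tree_poly s 2 (i + j + 2) c d k"
proof -
  have *: "Suc (n + 2) = n + 3" "Suc 2 = 3" for n by simp_all
  show ?thesis
    unfolding tree_poly_def Let_def * using assms
    using fibp_mult_le[of s i j]
    by (simp add: fibp_pos lin_rec_pos mult_right_mono less_imp_le ac_simps del: lin_rec.simps)
qed

lemma tree_poly_branches_le:
  assumes "s > 0"
  shows "tree_poly s (i + 2) (j + 2) (k + 2) (l + 2) m \<le> tree_poly s 2 (i + j + 2) 2 (k + l + 2) m"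
  using tree_poly_branch_le[OF assms, of i j "k + 2" "l + 2" m]
    tree_poly_branch_le[OF assms, of k l 2 "i + j + 2" m]
  unfolding tree_poly_commute[of s "k + 2" "l + 2" 2 "i + j + 2" m]
    tree_poly_commute[of s 2 "k + l + 2" 2 "i + j + 2" m] 
  by (rule order_trans)

text \<open>Writing \<open>lin_rec\<close> in terms of \<open>fibp\<close> turns the comparisons
  below into polynomial identities.\<close>

lemma tree_poly_Suc:
  "tree_poly s a b c d (Suc k) =
     fibp s (Suc (Suc (a + b))) * (fibp s (Suc (Suc (c + d))) * (s * fibp s (Suc k) + fibp s k)
         + fibp s (Suc c) * fibp s (Suc d) * fibp s (Suc k))
     + fibp s (Suc a) * fibp s (Suc b) * (fibp s (Suc (Suc (c + d))) * fibp s (Suc k)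
         + fibp s (Suc c) * fibp s (Suc d) * fibp s k)"
proof -
  define Q where "Q = fibp s (Suc c) * fibp s (Suc d)"
  define Y where "Y = fibp s (Suc (Suc (c + d)))"
  show ?thesis
    by (simp only: tree_poly_def Let_def Q_def[symmetric] Y_def[symmetric]
        lin_rec_Suc[of s Q Y] lin_rec.simps(3)[of s 0 1 k])
qed

text \<open>Here i + 1 vertices move from a pendent path to the path between the branch vertices.
  This identity and the next supply initial values for a recurrence in the number of inner
  vertices.\<close>

lemma tree_poly_shift_0:
  "tree_poly s 2 2 2 (Suc t) (Suc (Suc i)) - tree_poly s 2 (i + 3) 2 (Suc t) (Suc 0)
    = s * fibp s (Suc i) * (fibp s 3 * fibp s (Suc t) + s * fibp s (Suc (Suc t)))"
  unfolding tree_poly_Suc unfolding fibp_eval by Groebner_Basis.algebra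

lemma tree_poly_shift_1:
  "tree_poly s 2 2 2 (Suc t) (Suc (Suc (Suc i))) - tree_poly s 2 (i + 3) 2 (Suc t) (Suc (Suc 0))
    = s * fibp s (Suc i) * (fibp s 3 * fibp s (Suc (Suc t)))"
  unfolding tree_poly_Suc unfolding fibp_eval by Groebner_Basis.algebra

lemma tree_poly_0: 
  "tree_poly s a b c d 0 =
     fibp s (Suc (Suc (a + b))) * fibp s (Suc (Suc (c + d)))
     + fibp s (Suc a) * fibp s (Suc b) * (fibp s (Suc c) * fibp s (Suc d))"
  by (simp add: tree_poly_def Let_def)

lemma tree_poly_adjacent_diff:
  "tree_poly s 2 2 2 (i + j + 2) 0 - tree_poly s 2 (i + 2) 2 (j + 2) 0
      = (s ^ 4 + 2 * s ^ 2) * (fibp s i * fibp s j)"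
proof -
  have "i + j + 2 = Suc (i + Suc j)"
    by simp
  have e: "Suc (Suc (2 + Suc (i + Suc j))) = Suc (i + Suc (Suc (Suc (Suc (Suc j)))))"
   "Suc (Suc (i + Suc j)) = Suc (i + Suc (Suc j))"
    by simp_all
  show ?thesis
    unfolding \<open>i + j + 2 = _\<close> tree_poly_0 unfolding e fibp_add unfolding fibp_eval by Groebner_Basis.algebra
qed

text \<open>The factor \<open>1 - s ^ 4\<close> changes sign at s = 1, so these two trees cannot be
  compared pointwise.\<close>

lemma tree_poly_2_diff:
  "tree_poly s 2 2 2 2 (Suc k) - tree_poly s 2 2 2 (k + 3) 0 = s * (1 - s ^ 4) * fibp s (Suc k)"
  unfolding tree_poly_Suc tree_poly_0 unfolding fibp_eval by Groebner_Basis.algebra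

lemma tree_poly_2_expand:
  "tree_poly s 2 2 2 2 (Suc k) =
     (6*s + 29*s^3 + 48*s^5 + 34*s^7 + 10*s^9 + s^11) * fibp s (Suc k)
     + (1 + 13*s^2 + 30*s^4 + 26*s^6 + 9*s^8 + s^10) * fibp s k"
  unfolding tree_poly_Suc unfolding fibp_eval by Groebner_Basis.algebra


section \<open>Pointwise comparison when the branch vertices are not adjacent\<close>

lemma tree_poly_shift_less:
  assumes "s > 0"
  shows "tree_poly s 2 (i + 3) 2 (Suc t) (Suc k) < tree_poly s 2 2 2 (Suc t) (Suc (Suc (k + i)))"
proof -
  \<comment> \<open>In k the difference obeys the recurrence again, so its positivity follows from
    that of its first two values.\<close>
  define \<Delta> where "\<Delta> k = tree_poly s 2 2 2 (Suc t) (Suc (Suc (k + i)))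
    - tree_poly s 2 (i + 3) 2 (Suc t) (Suc k)" for k
  have pos: "fibp s (Suc n) > 0" "fibp s 3 > 0" for n
    using fibp_pos[OF assms] by (simp_all add: numeral_3_eq_3 del: lin_rec.simps)
  have "\<Delta> 0 > 0" "\<Delta> (Suc 0) > 0"
    unfolding \<Delta>_def add_0 add_Suc tree_poly_shift_0 tree_poly_shift_1
    by (intro mult_pos_pos add_pos_pos pos assms)+
  moreover have "\<Delta> k = lin_rec s (\<Delta> 0) (\<Delta> (Suc 0)) k"
    by (rule lin_rec_unique) (simp add: \<Delta>_def tree_poly_rec algebra_simps)
  ultimately have "\<Delta> k > 0"
    using lin_rec_pos[OF assms] by metis
  then show ?thesis
    by (simp add: \<Delta>_def)
qed

text \<open>The two long pendent paths are shortened one after the other, exchanging the branch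
  vertices in between; a positive i or j makes one of the steps strict.\<close>

lemma tree_poly_long_path_less:
  assumes "s > 0" "i + j > 0"
  shows "tree_poly s 2 (i + 2) 2 (j + 2) (Suc k) < tree_poly s 2 2 2 2 (Suc (k + i + j))"
proof -
  have less: "tree_poly s 2 (Suc i + 2) 2 (j + 2) (Suc k) < tree_poly s 2 2 2 (j + 2) (Suc (k + Suc i))"
    for i j k
    using tree_poly_shift_less[OF assms(1), of "i" "Suc j" k] by (simp add: eval_nat_numeral)
  have le: "tree_poly s 2 (i + 2) 2 (j + 2) (Suc k) \<le> tree_poly s 2 2 2 (j + 2) (Suc (k + i))"
    for i j k
  proof (cases i)
    case (Suc i')
    then show ?thesis using less[of i' j k] by (auto intro: less_imp_le)
  qed (simp add: numeral_2_eq_2)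
  have comm: "tree_poly s 2 2 2 (j + 2) (Suc (k + i)) = tree_poly s 2 (j + 2) 2 2 (Suc (k + i))"
    by (rule tree_poly_commute)
  show ?thesis
  proof (cases i)
    case 0
    then obtain j' where "j = Suc j'"
      using assms(2) by (cases j) auto
    then show ?thesis
      using less[of j' 0 k] comm 0 by (simp add: numeral_2_eq_2)
  next
    case (Suc i')
    have "tree_poly s 2 (i + 2) 2 (j + 2) (Suc k) < tree_poly s 2 (j + 2) 2 2 (Suc (k + i))"
      using less[of i' j k] comm Suc by simp
    also have "\<dots> \<le> tree_poly s 2 2 2 2 (Suc (k + i + j))"
      using le[of j 0 "k + i"] by (simp add: numeral_2_eq_2)
    finally show ?thesis .
  qed
qed



section \<open>Adjacent branch vertices\<close>

lemma tree_poly_adjacent_le: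
  assumes "s > 0"
  shows "tree_poly s 2 (i + 2) 2 (j + 2) 0 \<le> tree_poly s 2 2 2 (i + j + 2) 0"
proof -
  have "(s ^ 4 + 2 * s ^ 2) * (fibp s i * fibp s j) \<ge> 0"
    using assms by (simp add: fibp_nonneg)
  then show ?thesis
    using tree_poly_adjacent_diff[of s i j] by linarith
qed

text \<open>Both s u(k) / u(k+1) and s u(k+1) / u(k) are increasing in s, where u(k) = fibp s k;
  either statement is the induction step for the other.\<close>

lemma fibp_ratio_mono:
  assumes "0 < s" "s \<le> w"
  shows "s * fibp s k * fibp w (Suc k) \<le> w * fibp w k * fibp s (Suc k)" (is "?P k")
    and "s * fibp w k * fibp s (Suc k) \<le> w * fibp s k * fibp w (Suc k)" (is "?Q k")
proof -
  have "?P k \<and> ?Q k"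
  proof (induction k)
    case (Suc k)
    have "s * s * (fibp s (Suc k) * fibp w (Suc k)) \<le> w * w * (fibp s (Suc k) * fibp w (Suc k))"
      using assms by (intro mult_right_mono mult_mono mult_nonneg_nonneg fibp_nonneg) auto
    with Suc show ?case
      by (simp add: algebra_simps)
  qed simp
  then show "?P k" "?Q k"
    by simp_all
qed

text \<open>By \<open>tree_poly_2_diff\<close>, and after division by \<open>y ^ 4 - 1\<close>, this
  says that the relative gain at 1 / y, weighted by 1 / y ^ 2, exceeds the relative loss at
  y.\<close>

lemma tree_poly_2_reciprocal:
  assumes "y > 1"
  shows "y ^ 8 * fibp y (Suc k) * tree_poly (1 / y) 2 2 2 2 (Suc k)
    < fibp (1 / y) (Suc k) * tree_poly y 2 2 2 2 (Suc k)"
proof -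
  define a b a' b' where defs: "a = fibp y (Suc k)" "b = fibp y k"
    "a' = fibp (1 / y) (Suc k)" "b' = fibp (1 / y) k"
  \<comment> \<open>\<open>A\<close> and \<open>B\<close> are the coefficients in
    \<open>tree_poly_2_expand\<close> at 1 / y, multiplied by \<open>y ^ 11\<close> and
    \<open>y ^ 10\<close>.\<close>
  define A where "A = 6*y^10 + 29*y^8 + 48*y^6 + 34*y^4 + 10*y^2 + 1"
  define B where "B = 1 + 9*y^2 + 26*y^4 + 30*y^6 + 13*y^8 + y^10"
  have y: "y > 0"
    using assms by simp
  have pos: "a > 0" "a' > 0" "b \<ge> 0" "b' \<ge> 0"
    using y by (auto simp: defs fibp_pos fibp_nonneg simp del: lin_rec.simps)
  have "B > 0"
    unfolding B_def using y by (intro add_pos_pos mult_pos_pos zero_less_power) auto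
  \<comment> \<open>The monotone ratio trades \<open>b'\<close> for \<open>b\<close>, after which
    \<open>a'\<close> is a common factor.\<close>
  have "1 / y * b' * a \<le> y * b * a'"
    unfolding defs using assms by (intro fibp_ratio_mono) (auto intro: order_trans[of _ 1])
  then have "b' * a \<le> y\<^sup>2 * b * a'"
    using y by (simp add: field_simps power2_eq_square)
  then have 1: "y * B * (b' * a) \<le> y * B * (y\<^sup>2 * b * a')"
    using y \<open>B > 0\<close> by (intro mult_left_mono) auto
  have 2: "y * b \<le> a"
    unfolding defs by (rule fibp_Suc_mult_le[OF y])
  \<comment> \<open>\<open>- C\<close> is the coefficient of \<open>y * b\<close> in the final
    difference; as \<open>y * b\<close> is at most \<open>a\<close>, the coefficient of
    \<open>a\<close> can absorb it.\<close>
  define C where "C = 4 * y^4 * (1 + y^2) * (y^4 - 1)"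
  have "y ^ 4 > 1"
    using assms by (simp add: one_less_power)
  then have "C > 0"
    using y by (simp add: C_def add_pos_pos)
  then have 3: "C * (y * b) \<le> C * a"
    using 2 by (intro mult_left_mono) auto
  \<comment> \<open>This is the coefficient of \<open>a\<close> left after subtracting
    \<open>C\<close>; its terms are paired by exponents adding up to 14.\<close>
  have "y^14 + 10*y^12 + 24*y^10 + 15*y^8 > 15*y^6 + 24*y^4 + 10*y^2 + 1"
    using assms power_strict_increasing[of 6 8 y] power_strict_increasing[of 4 10 y]
      power_strict_increasing[of 2 12 y] one_less_power[of y 14] by linarith
  then have 4: "0 < (y^14 + 10*y^12 + 24*y^10 + 15*y^8 - (15*y^6 + 24*y^4 + 10*y^2 + 1)) * a"
    using pos by simp
  have e: "y ^ 8 * tree_poly (1 / y) 2 2 2 2 (Suc k) = (A * a' + y * B * b') / y ^ 3"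
    unfolding tree_poly_2_expand defs[symmetric] A_def B_def using y
    by (simp add: field_simps eval_nat_numeral)
  have "a * (A * a' + y * B * b') \<le> a' * (A * a + y ^ 3 * B * b)"
    using 1 by (simp add: algebra_simps eval_nat_numeral)
  also have "\<dots> < a' * (y ^ 3 * tree_poly y 2 2 2 2 (Suc k))"
  proof (intro mult_strict_left_mono)
    have "y ^ 3 * tree_poly y 2 2 2 2 (Suc k) - (A * a + y ^ 3 * B * b)
      = (y^14 + 10*y^12 + 24*y^10 + 15*y^8 - (15*y^6 + 24*y^4 + 10*y^2 + 1)) * a
        + (C * a - C * (y * b))"
      unfolding tree_poly_2_expand defs[symmetric] A_def B_def C_def by Groebner_Basis.algebra
    then show "A * a + y ^ 3 * B * b < y ^ 3 * tree_poly y 2 2 2 2 (Suc k)"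
      using 3 4 by linarith
  qed (use pos in auto)
  finally have "a * ((A * a' + y * B * b') / y ^ 3) < a' * tree_poly y 2 2 2 2 (Suc k)"
    using y by (simp add: field_simps)
  then show ?thesis
    unfolding e[symmetric] unfolding defs by (simp add: mult_ac)
qed

lemma tree_poly_2_ln_less:
  assumes "y > 1"
  shows "ln (tree_poly (1 / y) 2 2 2 (k + 3) 0) / y\<^sup>2 + ln (tree_poly y 2 2 2 (k + 3) 0)
    < ln (tree_poly (1 / y) 2 2 2 2 (Suc k)) / y\<^sup>2 + ln (tree_poly y 2 2 2 2 (Suc k))"
proof -
  define F where "F s = tree_poly s 2 2 2 (k + 3) 0" for s
  define G where "G s = tree_poly s 2 2 2 2 (Suc k)" for s
  have pos: "F s > 0" "G s > 0" if "s > 0" for s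
    unfolding F_def G_def by (intro tree_poly_pos that)+
  have diff: "G s - F s = s * (1 - s ^ 4) * fibp s (Suc k)" for s
    unfolding F_def G_def by (rule tree_poly_2_diff)
  \<comment> \<open>The bound serves twice: from below for the gain at 1 / y and from above for the
    loss at y, both with denominator \<open>G\<close>.\<close>
  have ln: "(G s - F s) / G s \<le> ln (G s) - ln (F s)" if "s > 0" for s
  proof -
    have "ln (F s / G s) \<le> F s / G s - 1"
      using pos[OF that] by (intro ln_le_minus_one) simp
    then show ?thesis
      using pos[OF that] by (simp add: ln_div field_simps)
  qed
  have y: "y > 0" "1 / y > 0" "y ^ 4 > 1"
    using assms by (simp_all add: one_less_power)
  have "y ^ 8 * fibp y (Suc k) * G (1 / y) < fibp (1 / y) (Suc k) * G y"
    unfolding G_def by (rule tree_poly_2_reciprocal[OF assms])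
  then have "y * fibp y (Suc k) / G y < fibp (1 / y) (Suc k) / (y ^ 7 * G (1 / y))"
    using pos(2)[OF y(1)] pos(2)[OF y(2)] y by (simp add: field_simps eval_nat_numeral)
  then have "(y ^ 4 - 1) * (y * fibp y (Suc k) / G y)
      < (y ^ 4 - 1) * (fibp (1 / y) (Suc k) / (y ^ 7 * G (1 / y)))"
    using y by (intro mult_strict_left_mono) auto
  moreover have "(y ^ 4 - 1) * (y * fibp y (Suc k) / G y) = - ((G y - F y) / G y)"
    unfolding diff by (simp add: algebra_simps diff_divide_distrib)
  moreover have "(y ^ 4 - 1) * (fibp (1 / y) (Suc k) / (y ^ 7 * G (1 / y)))
      = (G (1 / y) - F (1 / y)) / G (1 / y) / y\<^sup>2"
    unfolding diff using y pos(2)[OF y(2)] by (simp add: field_simps eval_nat_numeral)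
  moreover have "(G (1 / y) - F (1 / y)) / G (1 / y) / y\<^sup>2 \<le> (ln (G (1 / y)) - ln (F (1 / y))) / y\<^sup>2"
    using ln[OF y(2)] by (intro divide_right_mono) auto
  ultimately have "0 < (ln (G (1 / y)) - ln (F (1 / y))) / y\<^sup>2 + (ln (G y) - ln (F y))"
    using ln[OF y(1)] by linarith
  then show ?thesis
    by (simp add: F_def G_def diff_divide_distrib)
qed

section \<open>Comparison of energies\<close>

text \<open>A primitive in y of ln (1 + (l y)^2) / y^2 + ln (1 + (l / y)^2) which vanishes at y = 1
  and tends to pi * |l|.\<close>

definition energy_prim :: "real \<Rightarrow> real \<Rightarrow> real" where
  "energy_prim l y = 2 * l * arctan (l * y) - ln (1 + (l * y)\<^sup>2) / y
     + (y * ln (1 + (l / y)\<^sup>2) - 2 * l * arctan (l / y))"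

lemma energy_prim_1: "energy_prim l 1 = 0"
  by (simp add: energy_prim_def)

lemma energy_prim_deriv:
  assumes "y > 0"
  shows "(energy_prim l has_real_derivative
    ln (1 + (l * y)\<^sup>2) / y\<^sup>2 + ln (1 + (l / y)\<^sup>2)) (at y)"
proof -
  have pos: "1 + x\<^sup>2 > 0" for x :: real
    by (simp add: add_pos_nonneg)
  have arctan: "((\<lambda>y. arctan (g y)) has_real_derivative g' / (1 + (g y)\<^sup>2)) (at y)"
    and ln: "((\<lambda>y. ln (1 + (g y)\<^sup>2)) has_real_derivative 2 * g y * g' / (1 + (g y)\<^sup>2)) (at y)"
    if g: "(g has_real_derivative g') (at y)" for g g'
  proof -
    show "((\<lambda>y. arctan (g y)) has_real_derivative g' / (1 + (g y)\<^sup>2)) (at y)"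
      using DERIV_chain2[OF DERIV_arctan g] by (simp add: divide_inverse mult.commute)
    have "((\<lambda>y. 1 + (g y)\<^sup>2) has_real_derivative 2 * g y * g') (at y)"
      using DERIV_add[OF DERIV_const[of 1] DERIV_power[OF g, of 2]] by (simp add: mult_ac)
    from DERIV_chain2[OF DERIV_ln_divide[OF pos] this]
    show "((\<lambda>y. ln (1 + (g y)\<^sup>2)) has_real_derivative 2 * g y * g' / (1 + (g y)\<^sup>2)) (at y)"
      by simp
  qed
  have 1: "((\<lambda>y. l * y) has_real_derivative l) (at y)"
    using DERIV_cmult_Id[of l y] by simp
  have 2: "((\<lambda>y. l / y) has_real_derivative - (l / y\<^sup>2)) (at y)"
    using DERIV_cmult[OF DERIV_inverse[of y], of l UNIV] assms by (simp add: divide_inverse power2_eq_square)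
  define p q where "p = 1 + (l * y)\<^sup>2" and "q = 1 + (l / y)\<^sup>2"
  have pq: "p \<noteq> 0" "q \<noteq> 0"
    unfolding p_def q_def using pos[of "l * y"] pos[of "l / y"] by simp_all
  have "((\<lambda>y. 2 * l * arctan (l * y) - ln (1 + (l * y)\<^sup>2) / y) has_real_derivative
    ln p / y\<^sup>2) (at y)"
  proof (rule DERIV_cong)
    show "((\<lambda>y. 2 * l * arctan (l * y) - ln (1 + (l * y)\<^sup>2) / y) has_real_derivative
        2 * l * (l / p) - (2 * (l * y) * l / p * y - ln p * 1) / (y * y)) (at y)"
      unfolding p_def using assms
      by (intro DERIV_diff DERIV_cmult DERIV_divide arctan[OF 1] ln[OF 1] DERIV_ident) simp
    show "2 * l * (l / p) - (2 * (l * y) * l / p * y - ln p * 1) / (y * y) = ln p / y\<^sup>2"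
      using assms pq(1) by (simp add: field_simps power2_eq_square)
  qed
  moreover have "((\<lambda>y. y * ln (1 + (l / y)\<^sup>2) - 2 * l * arctan (l / y)) has_real_derivative ln q) (at y)"
  proof (rule DERIV_cong)
    show "((\<lambda>y. y * ln (1 + (l / y)\<^sup>2) - 2 * l * arctan (l / y)) has_real_derivative
        (1 * ln q + 2 * (l / y) * (- (l / y\<^sup>2)) / q * y) - 2 * l * (- (l / y\<^sup>2) / q)) (at y)"
      unfolding q_def
      by (intro DERIV_diff DERIV_cmult DERIV_mult arctan[OF 2] ln[OF 2] DERIV_ident)
    show "(1 * ln q + 2 * (l / y) * (- (l / y\<^sup>2)) / q * y) - 2 * l * (- (l / y\<^sup>2) / q) = ln q"
      using assms pq(2) by (simp add: field_simps power2_eq_square)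
  qed
  ultimately show ?thesis
    unfolding energy_prim_def[abs_def] p_def q_def by (rule DERIV_add)
qed

lemma energy_prim_abs: "energy_prim \<bar>l\<bar> = energy_prim l"
  by (cases "l \<ge> 0") (simp_all add: energy_prim_def fun_eq_iff arctan_minus)

text \<open>Only \<open>2 * l * arctan (l * y)\<close> survives in the limit. Evenness in l reduces
  the claim to l > 0 and the trivial l = 0.\<close>

lemma energy_prim_tendsto: "(energy_prim l \<longlongrightarrow> pi * \<bar>l\<bar>) at_top"
proof -
  have "(energy_prim l \<longlongrightarrow> pi * l) at_top" if "l \<ge> 0" for l
  proof (cases "l = 0")
    case False
    with that have "l > 0" by simp
    then show ?thesis
      unfolding energy_prim_def by real_asymp
  qed (simp add: energy_prim_def[abs_def])
  from this[of "\<bar>l\<bar>"] show ?thesis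
    by (simp add: energy_prim_abs)
qed

text \<open>The difference of the summed primitives vanishes at 1, increases strictly, and tends to
  pi times the difference of the two sides. Its value at 2 bounds the limit away from 0.\<close>

lemma energy_compare:
  fixes xs zs :: "real list"
  assumes "\<And>y. y > 1 \<Longrightarrow>
      (\<Sum>l\<leftarrow>xs. ln (1 + (l * y)\<^sup>2) / y\<^sup>2 + ln (1 + (l / y)\<^sup>2))
    < (\<Sum>l\<leftarrow>zs. ln (1 + (l * y)\<^sup>2) / y\<^sup>2 + ln (1 + (l / y)\<^sup>2))"
  shows "(\<Sum>l\<leftarrow>xs. \<bar>l\<bar>) < (\<Sum>l\<leftarrow>zs. \<bar>l\<bar>)"
proof -
  define S where "S ls y = (\<Sum>l\<leftarrow>ls. energy_prim l y)" for ls y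
  define S' where "S' ls y = (\<Sum>l\<leftarrow>ls. ln (1 + (l * y)\<^sup>2) / y\<^sup>2 + ln (1 + (l / y)\<^sup>2))" for ls and y :: real
  have S_1: "S ls 1 = 0" for ls
    by (simp add: S_def energy_prim_1)
  have S_deriv: "(S ls has_real_derivative S' ls y) (at y)" if "y > 0" for ls y
    unfolding S_def[abs_def] S'_def
    by (induction ls) (auto intro!: DERIV_add energy_prim_deriv that)
  have S_tendsto: "(S ls \<longlongrightarrow> pi * (\<Sum>l\<leftarrow>ls. \<bar>l\<bar>)) at_top" for ls
    unfolding S_def[abs_def]
    by (induction ls) (auto simp: distrib_left intro!: tendsto_add energy_prim_tendsto)
  define H where "H y = S zs y - S xs y" for y
  have deriv: "(H has_real_derivative S' zs y - S' xs y) (at y)" if "y > 0" for y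
    unfolding H_def[abs_def] by (intro DERIV_diff S_deriv that)
  have less: "H a < H b" if "1 \<le> a" "a < b" for a b
  proof (rule DERIV_pos_imp_increasing_open[OF that(2)])
    fix y assume "a < y" "y < b"
    with that show "\<exists>d. (H has_real_derivative d) (at y) \<and> 0 < d"
      using deriv[of y] assms[of y] by (auto simp: S'_def)
  next
    show "continuous_on {a..b} H"
      using that by (intro continuous_at_imp_continuous_on ballI DERIV_isCont[OF deriv]) auto
  qed
  have "H 1 < H 2" and "eventually (\<lambda>y. H 2 \<le> H y) at_top"
    using less[of 1 2] less[of 2] by (auto simp: eventually_at_top_linorder le_less intro!: exI[of _ 2])
  moreover have "(H \<longlongrightarrow> pi * (\<Sum>l\<leftarrow>zs. \<bar>l\<bar>) - pi * (\<Sum>l\<leftarrow>xs. \<bar>l\<bar>)) at_top"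
    unfolding H_def[abs_def] by (intro tendsto_diff S_tendsto)
  ultimately have "H 2 \<le> pi * (\<Sum>l\<leftarrow>zs. \<bar>l\<bar>) - pi * (\<Sum>l\<leftarrow>xs. \<bar>l\<bar>)"
    by (intro tendsto_lowerbound) auto
  moreover have "H 1 = 0"
    by (simp add: H_def S_1)
  ultimately have "pi * (\<Sum>l\<leftarrow>xs. \<bar>l\<bar>) < pi * (\<Sum>l\<leftarrow>zs. \<bar>l\<bar>)"
    using \<open>H 1 < H 2\<close> by linarith
  then show ?thesis
    by simp
qed

section \<open>Removal of pendent paths\<close>

definition simple_graph :: "graph \<Rightarrow> bool" where
  "simple_graph G \<longleftrightarrow> (\<forall>e\<in>snd G. \<exists>u<fst G. \<exists>v<fst G. u \<noteq> v \<and> e = {u, v})"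

text \<open>With purely imaginary diagonal entries, eliminating a pendent vertex of weight w changes the
  weight of its neighbour by + 1 / w. So weights stay positive and no pivot vanishes.\<close>

definition weighted_det :: "(nat \<Rightarrow> real) \<Rightarrow> graph \<Rightarrow> complex" where
  "weighted_det w G = det (mat (fst G) (fst G) (\<lambda>(i, j).
     if i = j then \<i> * of_real (w i) else if {i, j} \<in> snd G then -1 else 0))"

lemma weighted_det_cong:
  assumes "\<And>i. i < fst G \<Longrightarrow> w i = w' i"
  shows "weighted_det w G = weighted_det w' G"
  unfolding weighted_det_def using assms by (intro arg_cong[of _ _ det] eq_matI) auto

lemma simple_graph_edgeD:
  assumes "simple_graph (k, E)" "{i, j} \<in> E"
  shows "i < k" "j < k" "i \<noteq> j"
proof -
  obtain u v where "u < k" "v < k" "u \<noteq> v" "{i, j} = {u, v}"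
    using assms unfolding simple_graph_def fst_conv snd_conv by blast
  then show "i < k" "j < k" "i \<noteq> j"
    unfolding doubleton_eq_iff by auto
qed

lemma simple_graph_pendant:
  assumes "simple_graph (k, E)" "v < k"
  shows "simple_graph (Suc k, insert {v, k} E)"
  unfolding simple_graph_def fst_conv snd_conv
proof (intro ballI)
  fix e assume "e \<in> insert {v, k} E"
  then consider "e = {v, k}" | "e \<in> E"
    by blast
  then show "\<exists>u<Suc k. \<exists>v<Suc k. u \<noteq> v \<and> e = {u, v}"
  proof cases
    case 1
    with assms(2) show ?thesis
      by (intro exI[of _ v] exI[of _ k] conjI) simp_all
  next
    case 2
    with assms(1) show ?thesis
      unfolding simple_graph_def fst_conv snd_conv by (meson less_SucI)
  qed
qed

text \<open>Adding row k, divided by its pivot, to row v clears column k except for the pivot. The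
  diagonal entry at v gains - 1 / (i w) = i / w with w = \<open>w k\<close>.\<close>

lemma weighted_det_pendant:
  assumes "simple_graph (k, E)" "v < k" "w k > 0"
  shows "weighted_det w (Suc k, insert {v, k} E)
    = \<i> * of_real (w k) * weighted_det (w(v := w v + 1 / w k)) (k, E)"
proof -
  define M where "M = mat (Suc k) (Suc k) (\<lambda>(i, j).
     if i = j then \<i> * of_real (w i) else if {i, j} \<in> insert {v, k} E then -1 else 0 :: complex)"
  define N where "N = addrow (1 / (\<i> * of_real (w k))) v k M"
  have M: "M \<in> carrier_mat (Suc k) (Suc k)"
    by (simp add: M_def)
  then have N: "N \<in> carrier_mat (Suc k) (Suc k)"
    by (simp add: N_def)
  have not_edge: "{i, k} \<notin> E" "{k, i} \<notin> E" for i
    using simple_graph_edgeD[OF assms(1), of i k] simple_graph_edgeD[OF assms(1), of k i] by auto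
  have N_index: "N $$ (i, j) = (if i = v then 1 / (\<i> * of_real (w k)) * M $$ (k, j) + M $$ (v, j)
      else M $$ (i, j))" if "i \<le> k" "j \<le> k" for i j
    using that by (simp add: N_def M_def)
  have col: "N $$ (i, k) = (if i = k then \<i> * of_real (w k) else 0)" if "i \<le> k" for i
    using that assms(2,3) not_edge unfolding N_index[OF that order_refl]
    by (auto simp: M_def doubleton_eq_iff)
  define B where "B = mat k k (\<lambda>(i, j). if i = j then \<i> * of_real ((w(v := w v + 1 / w k)) i)
      else if {i, j} \<in> E then -1 else 0)"
  have del: "mat_delete N k k = B"
  proof (rule eq_matI)
    fix i j
    assume "i < dim_row B" "j < dim_col B"
    then have ij: "i < k" "j < k"
      by (simp_all add: B_def)
    then have "mat_delete N k k $$ (i, j) = N $$ (i, j)"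
      using N by (simp add: mat_delete_def)
    also have "\<dots> = B $$ (i, j)"
      using ij assms(2,3) not_edge
      by (auto simp: N_index M_def B_def doubleton_eq_iff field_simps)
    finally show "mat_delete N k k $$ (i, j) = B $$ (i, j)" .
  qed (use N in \<open>simp_all add: mat_delete_def B_def\<close>)
  have "det M = det N"
    unfolding N_def using M assms(2) by (intro det_addrow[symmetric]) auto
  also have "\<dots> = (\<Sum>i<Suc k. N $$ (i, k) * cofactor N i k)"
    by (rule laplace_expansion_column[OF N]) simp
  also have "\<dots> = \<i> * of_real (w k) * det (mat_delete N k k)"
    by (simp add: col cofactor_def)
  finally show ?thesis
    by (simp only: weighted_det_def M_def del B_def fst_conv snd_conv)
qed

text \<open>Splitting off the first new vertex permits induction on the length: the rest is a
  pendent path at k in a larger graph.\<close>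

lemma attach_pendent_path_Suc:
  "attach_pendent_path v (Suc l) (k, E) = attach_pendent_path k l (Suc k, insert {v, k} E)"
proof -
  have *: "{f i |i. i < n} = f ` {..<n}" for f :: "nat \<Rightarrow> nat set" and n
    by auto
  have "(if i = 0 then k else Suc k + i - 1) = k + i" for i
    by simp
  then show ?thesis
    unfolding attach_pendent_path.simps * lessThan_Suc_eq_insert_0 image_insert image_image by simp
qed

lemma attach_pendent_path_0: "attach_pendent_path v 0 G = G"
  by (cases G) simp

lemma simple_graph_attach:
  assumes "simple_graph G" "v < fst G"
  shows "simple_graph (attach_pendent_path v l G)"
  using assms
proof (induction l arbitrary: v G)
  case 0
  then show ?case
    by (simp only: attach_pendent_path_0)
next
  case (Suc l)
  obtain k E where G: "G = (k, E)"
    by (cases G)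
  show ?case
    unfolding G attach_pendent_path_Suc using Suc.prems
    by (intro Suc.IH) (auto simp: G simple_graph_pendant)
qed

lemma fst_attach: "fst (attach_pendent_path v l G) = fst G + l"
  by (cases G) simp

text \<open>Elimination from the far end yields weights that form a continued fraction: ratios of
  consecutive \<open>lin_rec\<close> values, whose product telescopes. The last vertex has its own
  weight because it may be a branch vertex.\<close>

lemma weighted_det_attach_last:
  assumes "simple_graph (k, E)" "v < k" "s > 0" "w (k + l) > 0" "\<And>i. k \<le> i \<Longrightarrow> i < k + l \<Longrightarrow> w i = s"
  shows "weighted_det w (attach_pendent_path v (Suc l) (k, E))
    = \<i> ^ Suc l * of_real (lin_rec s 1 (w (k + l)) (Suc l))
      * weighted_det (w(v := w v + lin_rec s 1 (w (k + l)) l / lin_rec s 1 (w (k + l)) (Suc l))) (k, E)"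
  using assms
proof (induction l arbitrary: k E v w)
  case 0
  then show ?case
    by (simp only: attach_pendent_path_Suc attach_pendent_path_0)
      (simp add: weighted_det_pendant del: fun_upd_apply)
next
  case (Suc l)
  define R where "R = lin_rec s 1 (w (k + Suc l))"
  have R: "R i > 0" "R (Suc (Suc i)) = s * R (Suc i) + R i" for i
    unfolding R_def using Suc.prems by (auto intro: lin_rec_pos)
  define w' where "w' = w(k := s + R l / R (Suc l))"
  have w'k: "w' k = R (Suc (Suc l)) / R (Suc l)"
    using R[of l] R(1)[of "Suc l"] by (simp add: w'_def field_simps)
  have "w k = s"
    using Suc.prems by simp
  have "weighted_det w (attach_pendent_path v (Suc (Suc l)) (k, E))
     = weighted_det w (attach_pendent_path k (Suc l) (Suc k, insert {v, k} E))"
    by (simp only: attach_pendent_path_Suc)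
  also have "\<dots> = \<i> ^ Suc l * of_real (R (Suc l)) * weighted_det w' (Suc k, insert {v, k} E)"
    using Suc.IH[of "Suc k" "insert {v, k} E" k w] Suc.prems \<open>w k = s\<close>
    by (simp add: R_def w'_def simple_graph_pendant del: lin_rec.simps attach_pendent_path.simps fun_upd_apply)
  also have "weighted_det w' (Suc k, insert {v, k} E)
    = \<i> * of_real (w' k) * weighted_det (w'(v := w' v + 1 / w' k)) (k, E)"
    using Suc.prems R(1) by (intro weighted_det_pendant) (auto simp: w'k)
  also have "weighted_det (w'(v := w' v + 1 / w' k)) (k, E)
    = weighted_det (w(v := w v + R (Suc l) / R (Suc (Suc l)))) (k, E)"
    unfolding w'k using Suc.prems by (intro weighted_det_cong) (auto simp: w'_def)
  finally have "weighted_det w (attach_pendent_path v (Suc (Suc l)) (k, E))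
    = \<i> ^ Suc (Suc l) * of_real (R (Suc l) * w' k)
      * weighted_det (w(v := w v + R (Suc l) / R (Suc (Suc l)))) (k, E)"
    by (simp only: of_real_mult power_Suc mult_ac)
  also have "R (Suc l) * w' k = R (Suc (Suc l))"
    unfolding w'k using R(1)[of "Suc l"] R(1)[of l] less_irrefl
    by (metis nonzero_mult_div_cancel_left times_divide_eq_right)
  finally show ?case
    unfolding R_def .
qed

lemma weighted_det_attach:
  assumes "simple_graph G" "v < fst G" "s > 0" "\<And>i. fst G \<le> i \<Longrightarrow> w i = s"
  shows "weighted_det w (attach_pendent_path v l G)
    = \<i> ^ l * of_real (fibp s (Suc l))
      * weighted_det (w(v := w v + fibp s l / fibp s (Suc l))) G"
proof (cases l)
  case 0
  then show ?thesis
    by (simp add: attach_pendent_path_0)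
next
  case (Suc l')
  show ?thesis
    using weighted_det_attach_last[of "fst G" "snd G" v s w l'] assms
    by (simp add: Suc lin_rec_fibp del: lin_rec.simps attach_pendent_path.simps fun_upd_apply)
qed

text \<open>This brings the path between the branch vertices under the same elimination
  lemma.\<close>

lemma path_graph_eq_attach: "path_graph (Suc m) = attach_pendent_path 0 m (1, {})"
proof -
  have "(if i = 0 then 0 else 1 + i - 1) = i" for i :: nat
    by simp
  then show ?thesis
    unfolding path_graph_def attach_pendent_path.simps by simp
qed

lemma fst_path_graph: "fst (path_graph m) = m"
  by (simp add: path_graph_def)

lemma simple_graph_path: "simple_graph (path_graph m)"
proof -
  have "\<exists>u<m. \<exists>v<m. u \<noteq> v \<and> {i, Suc i} = {u, v}" if "Suc i < m" for i
    using that by (intro exI[of _ i] exI[of _ "Suc i"] conjI) auto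
  then show ?thesis
    by (auto simp: simple_graph_def path_graph_def)
qed

lemma simple_graph_T:
  assumes "a + b + c + d + 2 \<le> n"
  shows "simple_graph (T n a b c d)" "fst (T n a b c d) = n"
  using assms unfolding T_def Let_def
  by (simp_all add: simple_graph_attach simple_graph_path fst_attach fst_path_graph
    del: attach_pendent_path.simps)

text \<open>The two ends have weights of their own: they are the branch vertices, altered by
  eliminating the pendent paths.\<close>

lemma weighted_det_path:
  assumes "s > 0" "w (Suc m) > 0" "\<And>i. 0 < i \<Longrightarrow> i \<le> m \<Longrightarrow> w i = s"
  shows "weighted_det w (path_graph (Suc (Suc m)))
    = \<i> ^ Suc (Suc m) * of_real (w 0 * lin_rec s 1 (w (Suc m)) (Suc m) + lin_rec s 1 (w (Suc m)) m)"
proof -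
  have "simple_graph (1, {})"
    by (simp add: simple_graph_def)
  moreover have "weighted_det w (1, {}) = \<i> * w 0" for w
    by (simp add: weighted_det_def det_single)
  moreover have "lin_rec s 1 (w (Suc m)) (Suc m) > 0"
    using assms by (intro lin_rec_pos) auto
  moreover define R where "R = lin_rec s 1 (w (Suc m))"
  ultimately have "weighted_det w (path_graph (Suc (Suc m)))
    = \<i> ^ Suc m * of_real (R (Suc m)) * (\<i> * of_real (w 0 + R m / R (Suc m)))"
    unfolding path_graph_eq_attach using assms
    by (subst weighted_det_attach_last) (auto simp del: lin_rec.simps attach_pendent_path.simps)
  also have "\<dots> = \<i> ^ Suc (Suc m) * of_real (R (Suc m) * (w 0 + R m / R (Suc m)))"
    by (simp only: power_Suc of_real_mult mult_ac)
  also have "R (Suc m) * (w 0 + R m / R (Suc m)) = w 0 * R (Suc m) + R m"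
    using \<open>lin_rec s 1 (w (Suc m)) (Suc m) > 0\<close> unfolding R_def[symmetric] by (simp add: distrib_left)
  finally show ?thesis
    unfolding R_def .
qed

lemma weighted_det_T:
  assumes "s > 0"
  shows "weighted_det (\<lambda>_. s) (T (a + b + c + d + k + 2) a b c d)
    = \<i> ^ (a + b + c + d + k + 2) * of_real (tree_poly s a b c d k)"
proof -
  define r where "r l = fibp s l / fibp s (Suc l)" for l
  have pos: "fibp s (Suc l) > 0" "r l \<ge> 0" for l
    using assms by (simp_all add: r_def fibp_pos fibp_nonneg del: lin_rec.simps)
  \<comment> \<open>A branch vertex and its pendent paths form a path of i + j + 1 vertices; this
    identity clears the denominators of the weights.\<close>
  have branch: "fibp s (Suc i) * fibp s (Suc j) * (s + r j + r i) = fibp s (Suc (Suc (i + j)))" for i j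
    using fibp_add[of s "Suc i" j] pos(1)[of i] pos(1)[of j]
    by (simp add: r_def field_simps)
  define w where "w = (\<lambda>_. s)(Suc k := s + r d + r c, 0 := s + r b + r a)"
  define P where "P = path_graph (Suc (Suc k))"
  have P: "fst P = Suc (Suc k)" "simple_graph P"
    by (simp_all add: P_def fst_path_graph simple_graph_path)
  have step: "weighted_det w (attach_pendent_path v l G)
      = \<i> ^ l * of_real (fibp s (Suc l)) * weighted_det w' G"
    if "simple_graph G" "v < fst G" "\<And>i. fst G \<le> i \<Longrightarrow> w i = s" "w' = w(v := w v + r l)"
    for w w' v l G
    unfolding that(4) r_def by (rule weighted_det_attach[OF that(1,2) assms that(3)])
  define Pa where "Pa = attach_pendent_path 0 a P"
  define Pb where "Pb = attach_pendent_path 0 b Pa"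
  define Pc where "Pc = attach_pendent_path (Suc k) c Pb"
  note attached = P Pa_def Pb_def Pc_def fst_attach simple_graph_attach
  have "a + b + c + d + k + 2 - a - b - c - d = Suc (Suc k)"
    by simp
  then have "T (a + b + c + d + k + 2) a b c d = attach_pendent_path (Suc k) d Pc"
    by (simp only: T_def Let_def P_def Pa_def Pb_def Pc_def diff_Suc_1)
  \<comment> \<open>The pendent paths are removed in reverse order of attachment, each raising the
    weight of its branch vertex by a value of \<open>r\<close>.\<close>
  also have "weighted_det (\<lambda>_. s) \<dots> = \<i> ^ d * of_real (fibp s (Suc d))
      * weighted_det ((\<lambda>_. s)(Suc k := s + r d)) Pc"
    by (rule step) (simp_all add: attached del: attach_pendent_path.simps)
  also have "weighted_det ((\<lambda>_. s)(Suc k := s + r d)) Pc = \<i> ^ c * of_real (fibp s (Suc c))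
      * weighted_det ((\<lambda>_. s)(Suc k := s + r d + r c)) Pb"
    unfolding Pc_def by (rule step) (simp_all add: attached del: attach_pendent_path.simps)
  also have "weighted_det ((\<lambda>_. s)(Suc k := s + r d + r c)) Pb = \<i> ^ b * of_real (fibp s (Suc b))
      * weighted_det ((\<lambda>_. s)(Suc k := s + r d + r c, 0 := s + r b)) Pa"
    unfolding Pb_def by (rule step) (simp_all add: attached del: attach_pendent_path.simps)
  also have "weighted_det ((\<lambda>_. s)(Suc k := s + r d + r c, 0 := s + r b)) Pa
    = \<i> ^ a * of_real (fibp s (Suc a)) * weighted_det w P"
    unfolding Pa_def by (rule step) (simp_all add: attached w_def del: attach_pendent_path.simps)
  also have "weighted_det w P = \<i> ^ Suc (Suc k)
      * of_real ((s + r b + r a) * lin_rec s 1 (s + r d + r c) (Suc k) + lin_rec s 1 (s + r d + r c) k)"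
    unfolding P_def using assms pos(2)[of c] pos(2)[of d]
    by (subst weighted_det_path[where s = s]) (auto simp: w_def simp del: lin_rec.simps)
  finally have "weighted_det (\<lambda>_. s) (T (a + b + c + d + k + 2) a b c d)
    = \<i> ^ (a + b + c + d + k + 2) * of_real (fibp s (Suc a) * fibp s (Suc b) * (fibp s (Suc c) * fibp s (Suc d))
      * ((s + r b + r a) * lin_rec s 1 (s + r d + r c) (Suc k) + lin_rec s 1 (s + r d + r c) k))"
    by (simp only: power_add power_Suc power2_eq_square of_real_mult mult_ac)
  also have "fibp s (Suc a) * fibp s (Suc b) * (fibp s (Suc c) * fibp s (Suc d))
      * ((s + r b + r a) * lin_rec s 1 (s + r d + r c) (Suc k) + lin_rec s 1 (s + r d + r c) k)
    = tree_poly s a b c d k"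
    unfolding tree_poly_def Let_def branch[symmetric]
      lin_rec_mult[of s "fibp s (Suc c) * fibp s (Suc d)" 1, simplified mult_1_right]
    by (simp only: distrib_left distrib_right mult_ac add_ac)
  finally show ?thesis .
qed

section \<open>The spectrum\<close>

lemma adjacency_matrix_carrier: "adjacency_matrix G \<in> carrier_mat (fst G) (fst G)"
  by (cases G) simp

lemma adjacency_matrix_eigenvalue_real:
  assumes "eigenvalue (adjacency_matrix G) x"
  shows "Im x = 0"
proof -
  define A where "A = adjacency_matrix G"
  define n where "n = fst G"
  have A: "A \<in> carrier_mat n n"
    unfolding A_def n_def by (rule adjacency_matrix_carrier)
  have sym: "transpose_mat A = A"
    by (cases G, rule eq_matI) (auto simp: A_def insert_commute)
  have real: "cnj (A $$ (i, j)) = A $$ (i, j)" if "i < n" "j < n" for i j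
    using that by (cases G) (auto simp: A_def n_def)
  obtain v where v: "v \<in> carrier_vec n" "v \<noteq> 0\<^sub>v n" "A *\<^sub>v v = x \<cdot>\<^sub>v v"
    using assms A unfolding A_def[symmetric] eigenvalue_def eigenvector_def by auto
  have "A *\<^sub>v conjugate v = conjugate (A *\<^sub>v v)"
    using A v(1) real by (intro eq_vecI) (auto simp: scalar_prod_def)
  then have conj: "A *\<^sub>v conjugate v = cnj x \<cdot>\<^sub>v conjugate v"
    using v by (simp add: conjugate_smult_vec)
  have "x * (v \<bullet>c v) = (A *\<^sub>v v) \<bullet>c v"
    using v by simp
  also have "\<dots> = (transpose_mat A *\<^sub>v v) \<bullet>c v"
    by (simp only: sym)
  also have "\<dots> = v \<bullet> (A *\<^sub>v conjugate v)"
    using A v by (intro transpose_vec_mult_scalar) auto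
  also have "\<dots> = cnj x * (v \<bullet>c v)"
    unfolding conj using v by simp
  finally have "x = cnj x"
    using v by simp
  then show ?thesis
    by (simp add: complex_eq_iff)
qed

lemma poly_char_poly_adjacency_matrix:
  assumes "simple_graph G"
  shows "poly (char_poly (adjacency_matrix G)) (\<i> * of_real s) = weighted_det (\<lambda>_. s) G"
proof -
  obtain k E where G: "G = (k, E)"
    by (cases G)
  \<comment> \<open>\<open>{i}\<close> is \<open>{i, i}\<close>: without loops, every diagonal entry
    is i s.\<close>
  have "{i} \<notin> E" for i
    using simple_graph_edgeD[of k E i i] assms by (auto simp: G)
  then show ?thesis
    unfolding char_poly_def weighted_det_def
    by (intro poly_det_cong[where n = k]) (auto simp: G char_poly_matrix_def)
qed

lemma order_prod_linear:
  fixes as :: "complex list"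
  shows "order x (\<Prod>a\<leftarrow>as. [:- a, 1:]) = count_list as x"
proof (induction as)
  case (Cons a as)
  have ne: "[:- a, 1:] * (\<Prod>a\<leftarrow>as. [:- a, 1:]) \<noteq> 0"
    unfolding mult_eq_0_iff prod_list_zero_iff by auto
  show ?case
    using Cons unfolding list.map prod_list.Cons order_mult[OF ne] by (simp add: order_linear')
qed simp

lemma sum_count_list:
  fixes f :: "'a \<Rightarrow> real"
  shows "(\<Sum>x\<in>set xs. real (count_list xs x) * f x) = (\<Sum>x\<leftarrow>xs. f x)"
proof -
  \<comment> \<open>A fixed superset \<open>X\<close> makes the induction work, as the set of
    entries can grow with the list.\<close>
  have "(\<Sum>x\<in>X. real (count_list xs x) * f x) = (\<Sum>x\<leftarrow>xs. f x)" if "finite X" "set xs \<subseteq> X" for X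
    using that(2)
  proof (induction xs)
    case (Cons a xs)
    have "real (count_list (a # xs) x) * f x = (if x = a then f x else 0) + real (count_list xs x) * f x" for x
      by (simp add: distrib_right)
    with Cons that(1) show ?case
      by (simp add: sum.distrib del: count_list.simps)
  qed simp
  then show ?thesis
    by simp
qed

text \<open>The eigenvalues become a real list with multiplicity; the product comes from |i s - l| ^
  2 = s ^ 2 + l ^ 2.\<close>

lemma adjacency_spectrum:
  assumes "simple_graph G"
  obtains ls :: "real list"
  where "length ls = fst G" "graph_energy G = (\<Sum>l\<leftarrow>ls. \<bar>l\<bar>)"
    "\<And>s. (\<Prod>l\<leftarrow>ls. s\<^sup>2 + l\<^sup>2) = (cmod (weighted_det (\<lambda>_. s) G))\<^sup>2"
proof -
  define A where "A = adjacency_matrix G"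
  have A: "A \<in> carrier_mat (fst G) (fst G)"
    unfolding A_def by (rule adjacency_matrix_carrier)
  obtain as where as: "char_poly A = (\<Prod>a\<leftarrow>as. [:- a, 1:])" "length as = fst G"
    using char_poly_factorized[OF A] by blast
  have spectrum: "spectrum A = set as"
    unfolding spectrum_root_char_poly[OF A] as(1) poly_prod_list
    by (auto simp: prod_list_zero_iff)
  have Im: "Im a = 0" if "a \<in> set as" for a
    using that adjacency_matrix_eigenvalue_real[of G a] spectrum
    by (auto simp: spectrum_def A_def)
  define ls where "ls = map Re as"
  have map_ls: "as = map of_real ls"
    unfolding ls_def map_map by (rule map_idI[symmetric]) (simp add: complex_eq_iff Im)
  show ?thesis
  proof
    show "length ls = fst G"
      by (simp add: ls_def as)
    have "graph_energy G = (\<Sum>x\<in>set as. real (count_list as x) * cmod x)"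
      by (simp add: graph_energy_def A_def[symmetric] spectrum as(1) order_prod_linear)
    also have "\<dots> = (\<Sum>a\<leftarrow>as. cmod a)"
      by (rule sum_count_list)
    also have "\<dots> = (\<Sum>l\<leftarrow>ls. \<bar>l\<bar>)"
      by (simp add: map_ls o_def)
    finally show "graph_energy G = (\<Sum>l\<leftarrow>ls. \<bar>l\<bar>)" .
    fix s :: real
    have "weighted_det (\<lambda>_. s) G = (\<Prod>a\<leftarrow>as. \<i> * of_real s - a)"
      unfolding poly_char_poly_adjacency_matrix[OF assms, symmetric] A_def[symmetric] as(1) poly_prod_list
      by (simp add: o_def)
    then have "weighted_det (\<lambda>_. s) G = (\<Prod>l\<leftarrow>ls. \<i> * of_real s - of_real l)"
      by (simp add: map_ls o_def)
    moreover have "(cmod (\<Prod>l\<leftarrow>ls. \<i> * of_real s - of_real l))\<^sup>2 = (\<Prod>l\<leftarrow>ls. s\<^sup>2 + l\<^sup>2)"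
      by (induction ls) (simp_all add: norm_mult power_mult_distrib cmod_power2)
    ultimately show "(\<Prod>l\<leftarrow>ls. s\<^sup>2 + l\<^sup>2) = (cmod (weighted_det (\<lambda>_. s) G))\<^sup>2"
      by simp
  qed
qed

text \<open>Powers of y are pulled out of the logarithms. The last summand depends only on y and the
  number of eigenvalues, so it cancels between graphs of equal order.\<close>

lemma sum_list_ln_eq:
  fixes ls :: "real list"
  assumes "y > 0"
  shows "(\<Sum>l\<leftarrow>ls. ln (1 + (l * y)\<^sup>2) / y\<^sup>2 + ln (1 + (l / y)\<^sup>2))
    = ln (\<Prod>l\<leftarrow>ls. (1 / y)\<^sup>2 + l\<^sup>2) / y\<^sup>2 + ln (\<Prod>l\<leftarrow>ls. y\<^sup>2 + l\<^sup>2)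
      + length ls * (2 * ln y / y\<^sup>2 - 2 * ln y)"
proof (induction ls)
  case (Cons l ls)
  have pos: "s\<^sup>2 + l\<^sup>2 > 0" "(\<Prod>l\<leftarrow>ls. s\<^sup>2 + l\<^sup>2) > 0" if "s > 0" for s l :: real and ls
    using that by (induction ls) (simp_all add: add_pos_nonneg)
  have 1: "ln (1 + (l * y)\<^sup>2) = ln ((1 / y)\<^sup>2 + l\<^sup>2) + 2 * ln y"
  proof -
    have "1 + (l * y)\<^sup>2 = ((1 / y)\<^sup>2 + l\<^sup>2) * y\<^sup>2"
      using assms by (simp add: field_simps power2_eq_square)
    then show ?thesis
      using assms pos(1)[of "1 / y" l] by (simp only: ln_mult_pos ln_realpow) (simp add: ln_mult_pos ln_realpow)
  qed
  have 2: "ln (1 + (l / y)\<^sup>2) = ln (y\<^sup>2 + l\<^sup>2) - 2 * ln y"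
  proof -
    have "y\<^sup>2 + l\<^sup>2 = (1 + (l / y)\<^sup>2) * y\<^sup>2"
      using assms by (simp add: field_simps power2_eq_square)
    then show ?thesis
      using assms by (simp add: ln_mult_pos ln_realpow add_pos_nonneg)
  qed
  have "ln (((1 / y)\<^sup>2 + l\<^sup>2) * (\<Prod>l\<leftarrow>ls. (1 / y)\<^sup>2 + l\<^sup>2))
    = ln ((1 / y)\<^sup>2 + l\<^sup>2) + ln (\<Prod>l\<leftarrow>ls. (1 / y)\<^sup>2 + l\<^sup>2)"
    "ln ((y\<^sup>2 + l\<^sup>2) * (\<Prod>l\<leftarrow>ls. y\<^sup>2 + l\<^sup>2)) = ln (y\<^sup>2 + l\<^sup>2) + ln (\<Prod>l\<leftarrow>ls. y\<^sup>2 + l\<^sup>2)"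
    using assms pos(1)[of "1 / y" l] pos(2)[of "1 / y" ls] pos[of y] by (simp_all add: ln_mult_pos)
  then show ?case
    unfolding list.map sum_list.Cons prod_list.Cons Cons.IH 1 2 list.size
    by (simp add: add_divide_distrib ring_distribs)
qed simp

lemma graph_energy_less:
  assumes "simple_graph G" "simple_graph H" "fst G = fst H"
    and less: "\<And>y. y > 1 \<Longrightarrow>
      ln (cmod (weighted_det (\<lambda>_. 1 / y) G)) / y\<^sup>2 + ln (cmod (weighted_det (\<lambda>_. y) G))
    < ln (cmod (weighted_det (\<lambda>_. 1 / y) H)) / y\<^sup>2 + ln (cmod (weighted_det (\<lambda>_. y) H))"
  shows "graph_energy G < graph_energy H"
proof -
  obtain xs where xs: "length xs = fst G" "graph_energy G = (\<Sum>l\<leftarrow>xs. \<bar>l\<bar>)"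
    "\<And>s. (\<Prod>l\<leftarrow>xs. s\<^sup>2 + l\<^sup>2) = (cmod (weighted_det (\<lambda>_. s) G))\<^sup>2"
    using adjacency_spectrum[OF assms(1)] by blast
  obtain zs where zs: "length zs = fst H" "graph_energy H = (\<Sum>l\<leftarrow>zs. \<bar>l\<bar>)"
    "\<And>s. (\<Prod>l\<leftarrow>zs. s\<^sup>2 + l\<^sup>2) = (cmod (weighted_det (\<lambda>_. s) H))\<^sup>2"
    using adjacency_spectrum[OF assms(2)] by blast
  have ln2: "ln (r\<^sup>2) = 2 * ln r" if "r \<ge> 0" for r :: real
    using that by (cases "r = 0") (simp_all add: ln_realpow)
  show ?thesis
    unfolding xs(2) zs(2)
  proof (rule energy_compare)
    fix y :: real
    assume y: "y > 1"
    then show "(\<Sum>l\<leftarrow>xs. ln (1 + (l * y)\<^sup>2) / y\<^sup>2 + ln (1 + (l / y)\<^sup>2))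
      < (\<Sum>l\<leftarrow>zs. ln (1 + (l * y)\<^sup>2) / y\<^sup>2 + ln (1 + (l / y)\<^sup>2))"
      using less[OF y] assms(3)
      by (simp add: sum_list_ln_eq xs(1) zs(1) xs(3)[of y] xs(3)[of "1 / y"] zs(3)[of y] zs(3)[of "1 / y"] ln2
        del: power_divide power_one_over)
  qed
qed

section \<open>Assembling the comparison of the trees\<close>

lemma tree_poly_ln_less:
  assumes "y > 1" "i + j + k + l > 0"
  shows "ln (tree_poly (1 / y) (i + 2) (j + 2) (k + 2) (l + 2) m) / y\<^sup>2
      + ln (tree_poly y (i + 2) (j + 2) (k + 2) (l + 2) m)
    < ln (tree_poly (1 / y) 2 2 2 2 (i + j + k + l + m)) / y\<^sup>2
      + ln (tree_poly y 2 2 2 2 (i + j + k + l + m))" (is "?L < ?R")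
proof -
  have y: "y > 0" "1 / y > 0"
    using assms by auto
  have ln_mono: "ln p / y\<^sup>2 + ln q \<le> ln p' / y\<^sup>2 + ln q'" if "0 < p" "p \<le> p'" "0 < q" "q \<le> q'" for p p' q q'
    using that by (intro add_mono divide_right_mono) auto
  have ln_strict: "ln p / y\<^sup>2 + ln q < ln p' / y\<^sup>2 + ln q'" if "0 < p" "p < p'" "0 < q" "q < q'" for p p' q q'
    using that y by (intro add_strict_mono divide_strict_right_mono) auto
  \<comment> \<open>At each branch vertex the excess over 2 is first collected in one pendent
    path.\<close>
  have L: "?L \<le> ln (tree_poly (1 / y) 2 (i + j + 2) 2 (k + l + 2) m) / y\<^sup>2
      + ln (tree_poly y 2 (i + j + 2) 2 (k + l + 2) m)" (is "_ \<le> ?M")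
    by (intro ln_mono tree_poly_pos tree_poly_branches_le y)
  have "?M < ?R"
  \<comment> \<open>With an inner vertex both logarithms increase; for adjacent branch vertices
    their weighted sum is compared.\<close>
  proof (cases m)
    case (Suc m')
    have "tree_poly s 2 (i + j + 2) 2 (k + l + 2) m < tree_poly s 2 2 2 2 (i + j + k + l + m)" if "s > 0" for s
      using tree_poly_long_path_less[OF that, of "i + j" "k + l" m'] assms(2) Suc
      by (simp add: ac_simps)
    then show ?thesis
      using y by (intro ln_strict tree_poly_pos) auto
  next
    case 0
    \<comment> \<open>The total excess is positive, so the subtraction is exact.\<close>
    define t where "t = i + j + k + l - 1"
    have t: "i + j + k + l + m = Suc t" "i + j + (k + l) + 2 = t + 3"
      using assms(2) 0 by (simp_all add: t_def)
    have "?M \<le> ln (tree_poly (1 / y) 2 2 2 (t + 3) 0) / y\<^sup>2 + ln (tree_poly y 2 2 2 (t + 3) 0)"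
      unfolding 0 using tree_poly_adjacent_le[of _ "i + j" "k + l"] unfolding t
      by (intro ln_mono tree_poly_pos y) (simp_all add: y)
    also have "\<dots> < ?R"
      unfolding t by (rule tree_poly_2_ln_less[OF assms(1)])
    finally show ?thesis .
  qed
  with L show ?thesis
    by (rule le_less_trans)
qed

theorem theorem4p3:
  fixes n a b c d :: nat
  assumes "n \<ge> 11"
    and "a \<ge> 2" and "b \<ge> 2" and "c \<ge> 2" and "d \<ge> 2"
    and "a + b + c + d \<le> n - 2"
    and "\<not> (a = 2 \<and> b = 2 \<and> c = 2 \<and> d = 2)"
  shows "graph_energy (T n a b c d) < graph_energy (T n 2 2 2 2)"
proof -
  obtain i j k l where abcd: "a = i + 2" "b = j + 2" "c = k + 2" "d = l + 2"
    using assms(2-5) by (metis le_add_diff_inverse2)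
  define m where "m = n - 2 - (a + b + c + d)"
  \<comment> \<open>In the second form the whole excess has moved into the path between the branch
    vertices.\<close>
  have n: "n = a + b + c + d + m + 2" "n = 2 + 2 + 2 + 2 + (i + j + k + l + m) + 2"
    using assms(1,6) by (simp_all add: m_def abcd)
  have det: "cmod (weighted_det (\<lambda>_. s) (T n a b c d)) = tree_poly s a b c d m"
    "cmod (weighted_det (\<lambda>_. s) (T n 2 2 2 2)) = tree_poly s 2 2 2 2 (i + j + k + l + m)" if "s > 0" for s
    using weighted_det_T[OF that, of a b c d m] weighted_det_T[OF that, of 2 2 2 2 "i + j + k + l + m"]
      tree_poly_pos[OF that] unfolding n(1)[symmetric] n(2)[symmetric]
    by (simp_all add: norm_mult norm_power less_imp_le)
  have le: "a + b + c + d + 2 \<le> n" "2 + 2 + 2 + 2 + 2 \<le> n"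
    using assms(1,6) by simp_all
  show ?thesis
  proof (rule graph_energy_less)
    fix y :: real
    assume y: "y > 1"
    have "i + j + k + l > 0"
      using assms(7) abcd by auto
    note less = tree_poly_ln_less[OF y this, of m]
    have "y > 0" "1 / y > 0"
      using y by simp_all
    then show "ln (cmod (weighted_det (\<lambda>_. 1 / y) (T n a b c d))) / y\<^sup>2
        + ln (cmod (weighted_det (\<lambda>_. y) (T n a b c d)))
      < ln (cmod (weighted_det (\<lambda>_. 1 / y) (T n 2 2 2 2))) / y\<^sup>2
        + ln (cmod (weighted_det (\<lambda>_. y) (T n 2 2 2 2)))"
      using less unfolding abcd[symmetric] by (simp only: det)
  qed (use simple_graph_T[OF le(1)] simple_graph_T[OF le(2)] in simp_all)
qed

end
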